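(* Let $A_m\in\mathbf{U}^m$. The following are equivalent: (i) $A_m$ is an extreme point of $\mathbf{U}^m$; (ii) for every entry of $A_m$ that has a minimal saturated neighborhood $A_\alpha$, this $A_\alpha$ is an extreme point of $\mathbf{U}^{|\alpha|}$; (iii) every saturated principal submatrix $A_\alpha$ of $A_m$ is an extreme point of $\mathbf{U}^{|\alpha|}$.
   Context: $I_m=\{1,\dots,m\}$. $\mathbf{U}_m$ is the set of real $m\times m$ matrices $A_m=(a_{ij})$ with $a_{ij}=a_{ji}\ge 0$ for all $i,j$ and $\sum_{i,j\in\alpha}a_{ij}\le|\alpha|$ for every $\alpha\subset I_m$ ($|\alpha|$ the cardinality), and $\mathbf{U}^m=\{A_m\in\mathbf{U}_m:\sum_{i,j=1}^m a_{ij}=m\}$. For $\alpha\subset I_m$ the principal submatrix $A_\alpha=(a_{ij})_{i,j\in\alpha}$ is regarded as an $|\alpha|\times|\alpha|$ matrix. A nonempty $\alpha\subset I_m$ is saturated if $\sum_{i,j\in\alpha}a_{ij}=|\alpha|$, and $A_\alpha$ is then a saturated principal submatrix. A saturated neighborhood of the entry $a_{ij}$ is a saturated principal submatrix $A_\beta$ with $i,j\in\beta$, of radius $|\beta|$; the minimal saturated neighborhood is the one of minimal radius (unique when it exists). *)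

theory Defs
  imports "Jordan_Normal_Form.DL_Submatrix"
begin

text \<open>Matrix indices start at 0, so the index set \<open>I_m\<close> is \<open>{..<m}\<close>.\<close>

definition U_set :: "nat \<Rightarrow> real mat set" where
  "U_set m = {A \<in> carrier_mat m m.
     (\<forall>i<m. \<forall>j<m. A $$ (i, j) = A $$ (j, i) \<and> 0 \<le> A $$ (i, j)) \<and>
     (\<forall>\<alpha>\<subseteq>{..<m}. (\<Sum>i\<in>\<alpha>. \<Sum>j\<in>\<alpha>. A $$ (i, j)) \<le> real (card \<alpha>))}"

definition U_top :: "nat \<Rightarrow> real mat set" where
  "U_top m = {A \<in> U_set m. (\<Sum>i<m. \<Sum>j<m. A $$ (i, j)) = real m}"

text \<open>The library predicate \<open>extreme_point_of\<close> needs a type of class \<open>real_vector\<close>, which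
  \<open>real mat\<close> (matrices of all dimensions in one type) is not; this is its unfolding for matrices.\<close>

definition mat_extreme_point_of :: "real mat \<Rightarrow> real mat set \<Rightarrow> bool"
    (infixr "mat'_extreme'_point'_of" 50) where
  "A mat_extreme_point_of S \<longleftrightarrow> A \<in> S \<and>
     (\<forall>B\<in>S. \<forall>C\<in>S. \<not> (B \<noteq> C \<and>
        (\<exists>t. 0 < t \<and> t < 1 \<and> A = (1 - t) \<cdot>\<^sub>m B + t \<cdot>\<^sub>m C)))"

definition principal_submatrix :: "real mat \<Rightarrow> nat set \<Rightarrow> real mat" where
  "principal_submatrix A \<alpha> = submatrix A \<alpha> \<alpha>"

definition saturated :: "real mat \<Rightarrow> nat set \<Rightarrow> bool" where
  "saturated A \<alpha> \<longleftrightarrow> \<alpha> \<noteq> {} \<and> \<alpha> \<subseteq> {..<dim_row A} \<and>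
     (\<Sum>i\<in>\<alpha>. \<Sum>j\<in>\<alpha>. A $$ (i, j)) = real (card \<alpha>)"

text \<open>Neighborhoods \<open>A_\<beta>\<close> are represented by their index sets \<open>\<beta>\<close>.\<close>

definition saturated_nbhd :: "real mat \<Rightarrow> nat \<Rightarrow> nat \<Rightarrow> nat set \<Rightarrow> bool" where
  "saturated_nbhd A i j \<beta> \<longleftrightarrow> saturated A \<beta> \<and> i \<in> \<beta> \<and> j \<in> \<beta>"

definition minimal_saturated_nbhd :: "real mat \<Rightarrow> nat \<Rightarrow> nat \<Rightarrow> nat set \<Rightarrow> bool" where
  "minimal_saturated_nbhd A i j \<alpha> \<longleftrightarrow> saturated_nbhd A i j \<alpha> \<and>
     (\<forall>\<beta>. saturated_nbhd A i j \<beta> \<longrightarrow> card \<alpha> \<le> card \<beta>)"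

end

theory Submission
  imports Defs
begin

text \<open>If \<open>A\<close> is a proper convex combination of \<open>B\<close> and \<open>C\<close>, every set saturated in \<open>A\<close> is saturated
  in \<open>B\<close> and \<open>C\<close>, so the combination restricts to saturated principal submatrices; as \<open>I_m\<close> itself
  is saturated, the minimal saturated neighborhoods cover all entries, and (ii) forces \<open>B = C\<close>.
  Conversely, a proper convex combination of \<open>B\<close> and \<open>C\<close> equal to \<open>A_\<alpha>\<close> gives the direction
  \<open>B - C\<close>, extended by zero. It vanishes where \<open>A\<close> does, and its sum over any saturated \<open>\<beta>\<close> is zero,
  because \<open>\<alpha> \<inter> \<beta>\<close> is again tight by supermodularity of \<open>\<beta> \<mapsto> \<Sum>i,j\<in>\<beta>. a_ij\<close>. Hence \<open>A\<close> can be
  moved both ways along it, and extremality of \<open>A\<close> makes it zero.\<close>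

section \<open>Principal sums and tight index sets\<close>

definition principal_sum :: "real mat \<Rightarrow> nat set \<Rightarrow> real" where
  "principal_sum A \<alpha> = (\<Sum>i\<in>\<alpha>. \<Sum>j\<in>\<alpha>. A $$ (i, j))"

lemma U_top_iff:
  "A \<in> U_top m \<longleftrightarrow> A \<in> carrier_mat m m \<and>
     (\<forall>i<m. \<forall>j<m. A $$ (i, j) = A $$ (j, i) \<and> 0 \<le> A $$ (i, j)) \<and>
     (\<forall>\<alpha>\<subseteq>{..<m}. principal_sum A \<alpha> \<le> real (card \<alpha>)) \<and>
     principal_sum A {..<m} = real m"
  unfolding U_top_def U_set_def principal_sum_def by auto

lemma saturated_iff:
  assumes "A \<in> U_top m"
  shows "saturated A \<alpha> \<longleftrightarrow> \<alpha> \<noteq> {} \<and> \<alpha> \<subseteq> {..<m} \<and> principal_sum A \<alpha> = real (card \<alpha>)"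
  using assms unfolding saturated_def U_top_iff principal_sum_def by auto

text \<open>The gaps \<open>c - u\<close> and \<open>c - v\<close> are nonnegative and their sum
  with positive weights is zero, so both vanish.\<close>

lemma convex_combination_eq_upper_bound:
  fixes u v c t :: real
  assumes "0 < t" "t < 1" "u \<le> c" "v \<le> c" "(1 - t) * u + t * v = c"
  shows "u = c" "v = c"
proof -
  have "(1 - t) * (c - u) + t * (c - v) = 0"
    using assms(5) by (simp add: algebra_simps)
  moreover have "(1 - t) * (c - u) \<ge> 0" "t * (c - v) \<ge> 0"
    using assms by simp_all
  ultimately have "(1 - t) * (c - u) = 0" "t * (c - v) = 0"
    by linarith+
  then show "u = c" "v = c"
    using assms by simp_all
qed

lemma convex_combination_index:
  fixes B C :: "real mat"
  assumes "B \<in> carrier_mat n n" "C \<in> carrier_mat n n" "i < n" "j < n"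
  shows "((1 - t) \<cdot>\<^sub>m B + t \<cdot>\<^sub>m C) $$ (i, j) = (1 - t) * B $$ (i, j) + t * C $$ (i, j)"
  using assms by auto

lemma principal_sum_convex_combination:
  assumes "B \<in> carrier_mat n n" "C \<in> carrier_mat n n" "\<gamma> \<subseteq> {..<n}"
  shows "principal_sum ((1 - t) \<cdot>\<^sub>m B + t \<cdot>\<^sub>m C) \<gamma> =
    (1 - t) * principal_sum B \<gamma> + t * principal_sum C \<gamma>"
proof -
  have "principal_sum ((1 - t) \<cdot>\<^sub>m B + t \<cdot>\<^sub>m C) \<gamma> =
      (\<Sum>i\<in>\<gamma>. \<Sum>j\<in>\<gamma>. (1 - t) * B $$ (i, j) + t * C $$ (i, j))"
    unfolding principal_sum_def
    by (intro sum.cong refl convex_combination_index[OF assms(1,2)]) (use assms(3) in auto)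
  then show ?thesis
    by (simp add: principal_sum_def sum.distrib sum_distrib_left)
qed

text \<open>The sums of \<open>B\<close> and \<open>C\<close> over \<open>\<gamma>\<close> are at
  most \<open>card \<gamma>\<close>, and a proper convex combination of them attains this bound.
  Unlike \<open>saturated\<close>, tightness is meant to include the empty set, which can arise as
  an intersection.\<close>

lemma tight_convex_combination:
  assumes "B \<in> U_top n" "C \<in> U_top n" "0 < t" "t < 1" "\<gamma> \<subseteq> {..<n}"
    and "principal_sum ((1 - t) \<cdot>\<^sub>m B + t \<cdot>\<^sub>m C) \<gamma> = real (card \<gamma>)"
  shows "principal_sum B \<gamma> = real (card \<gamma>)" "principal_sum C \<gamma> = real (card \<gamma>)"
  using convex_combination_eq_upper_bound[OF assms(3,4), of "principal_sum B \<gamma>" "real (card \<gamma>)" "principal_sum C \<gamma>"]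
    assms principal_sum_convex_combination[of B n C \<gamma> t]
  by (auto simp: U_top_iff)

text \<open>View each sum as one over index pairs: the squares of \<alpha> and \<beta> meet exactly
  in the square of \<alpha> \<inter> \<beta>, while their union may miss some pairs of the square of
  \<alpha> \<union> \<beta>. The missing pairs carry nonnegative entries.\<close>

lemma principal_sum_supermodular:
  assumes "A \<in> U_top m" "\<alpha> \<subseteq> {..<m}" "\<beta> \<subseteq> {..<m}"
  shows "principal_sum A \<alpha> + principal_sum A \<beta> \<le>
    principal_sum A (\<alpha> \<union> \<beta>) + principal_sum A (\<alpha> \<inter> \<beta>)"
proof -
  have fin: "finite \<alpha>" "finite \<beta>"
    using assms(2,3) finite_subset by blast+
  have prod: "principal_sum A \<gamma> = (\<Sum>p\<in>\<gamma> \<times> \<gamma>. A $$ p)" for \<gamma>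
    by (simp add: principal_sum_def sum.cartesian_product)
  have "principal_sum A \<alpha> + principal_sum A \<beta> =
      (\<Sum>p\<in>\<alpha> \<times> \<alpha> \<union> \<beta> \<times> \<beta>. A $$ p) + (\<Sum>p\<in>(\<alpha> \<times> \<alpha>) \<inter> (\<beta> \<times> \<beta>). A $$ p)"
    unfolding prod by (rule sum.union_inter[symmetric]) (use fin in auto)
  also have "(\<alpha> \<times> \<alpha>) \<inter> (\<beta> \<times> \<beta>) = (\<alpha> \<inter> \<beta>) \<times> (\<alpha> \<inter> \<beta>)"
    by auto
  also have "(\<Sum>p\<in>\<alpha> \<times> \<alpha> \<union> \<beta> \<times> \<beta>. A $$ p) \<le> (\<Sum>p\<in>(\<alpha> \<union> \<beta>) \<times> (\<alpha> \<union> \<beta>). A $$ p)"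
  proof (rule sum_mono2)
    fix p assume "p \<in> (\<alpha> \<union> \<beta>) \<times> (\<alpha> \<union> \<beta>) - (\<alpha> \<times> \<alpha> \<union> \<beta> \<times> \<beta>)"
    then have "fst p < m" "snd p < m"
      using assms(2,3) by auto
    then show "0 \<le> A $$ p"
      using assms(1) unfolding U_top_iff by (metis prod.collapse)
  qed (use fin in auto)
  finally show ?thesis
    by (simp add: prod)
qed

text \<open>Cardinality is modular, so supermodularity together with the upper bounds for the union
  and the intersection leaves no slack in either.\<close>

lemma tight_inter:
  assumes "A \<in> U_top m" "\<alpha> \<subseteq> {..<m}" "\<beta> \<subseteq> {..<m}"
    and "principal_sum A \<alpha> = real (card \<alpha>)" "principal_sum A \<beta> = real (card \<beta>)"
  shows "principal_sum A (\<alpha> \<inter> \<beta>) = real (card (\<alpha> \<inter> \<beta>))"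
proof -
  have "finite \<alpha>" "finite \<beta>"
    using assms(2,3) finite_subset by blast+
  then have "real (card \<alpha>) + real (card \<beta>) = real (card (\<alpha> \<union> \<beta>)) + real (card (\<alpha> \<inter> \<beta>))"
    using card_Un_Int[of \<alpha> \<beta>] by linarith
  moreover have "principal_sum A (\<alpha> \<union> \<beta>) \<le> real (card (\<alpha> \<union> \<beta>))"
    "principal_sum A (\<alpha> \<inter> \<beta>) \<le> real (card (\<alpha> \<inter> \<beta>))"
    using assms(1-3) unfolding U_top_iff by (auto simp: le_infI1)
  ultimately show ?thesis
    using principal_sum_supermodular[OF assms(1-3)] assms(4,5) by linarith
qed

section \<open>Moving an extreme point along a direction\<close>

text \<open>Read \<open>g\<close> as the slack of finitely many constraints and \<open>h\<close> as
  their rates of change: one positive step then respects all of them, since a constraint without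
  slack does not change.\<close>

lemma finite_common_step:
  fixes g h :: "'a \<Rightarrow> real"
  assumes "finite I" "\<And>x. x \<in> I \<Longrightarrow> 0 \<le> g x" "\<And>x. x \<in> I \<Longrightarrow> g x = 0 \<Longrightarrow> h x = 0"
  obtains e where "0 < e" "\<And>x. x \<in> I \<Longrightarrow> e * \<bar>h x\<bar> \<le> g x"
proof -
  have "\<exists>e>0. \<forall>x\<in>I. e * \<bar>h x\<bar> \<le> g x"
    using assms
  proof (induction I rule: finite_induct)
    case empty
    show ?case by (auto intro: exI[of _ 1])
  next
    case (insert y I)
    then obtain e where e: "e > 0" "\<forall>x\<in>I. e * \<bar>h x\<bar> \<le> g x"
      by auto
    \<comment> \<open>When \<open>h y\<close> is nonzero so is \<open>g y\<close>, hence the ratio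
      is a positive bound on the step; otherwise \<open>y\<close> imposes no bound.\<close>
    define d where "d = (if h y = 0 then e else min e (g y / \<bar>h y\<bar>))"
    have gy: "0 \<le> g y" "g y = 0 \<Longrightarrow> h y = 0"
      using insert.prems by auto
    then have d: "d > 0" "d \<le> e"
      using e(1) unfolding d_def by (force simp: order_less_le[of 0 "g y"] intro!: divide_pos_pos)+
    have "d * \<bar>h y\<bar> \<le> g y"
    proof (cases "h y = 0")
      case False
      then have "d \<le> g y / \<bar>h y\<bar>"
        by (simp add: d_def)
      with False show ?thesis
        by (simp add: field_simps)
    qed (use gy in simp)
    moreover have "d * \<bar>h x\<bar> \<le> g x" if "x \<in> I" for x
      using e(2) that mult_right_mono[OF d(2), of "\<bar>h x\<bar>"] by force
    ultimately show ?case
      using d(1) by auto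
  qed
  then show thesis
    using that by blast
qed

text \<open>For small \<open>s\<close> both \<open>A + s D\<close> and \<open>A - s D\<close> remain
  in \<open>U_top m\<close>, because only constraints with positive slack change. As
  \<open>A\<close> is their midpoint, extremality makes them equal.\<close>

lemma extreme_point_no_direction:
  fixes D :: "nat \<Rightarrow> nat \<Rightarrow> real"
  assumes ext: "A mat_extreme_point_of U_top m"
    and sym: "\<And>i j. i < m \<Longrightarrow> j < m \<Longrightarrow> D i j = D j i"
    and zero: "\<And>i j. i < m \<Longrightarrow> j < m \<Longrightarrow> A $$ (i, j) = 0 \<Longrightarrow> D i j = 0"
    and tight: "\<And>\<beta>. \<beta> \<subseteq> {..<m} \<Longrightarrow> principal_sum A \<beta> = real (card \<beta>) \<Longrightarrow>
      (\<Sum>i\<in>\<beta>. \<Sum>j\<in>\<beta>. D i j) = 0"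
    and ij: "i < m" "j < m"
  shows "D i j = 0"
proof -
  have A: "A \<in> U_top m"
    using ext by (simp add: mat_extreme_point_of_def)
  \<comment> \<open>The step \<open>d\<close> keeps the entries nonnegative; \<open>e\<close> below
    keeps the bounds on all principal sums.\<close>
  obtain d where d: "0 < d"
    "\<And>p. p \<in> {..<m} \<times> {..<m} \<Longrightarrow> d * \<bar>case_prod D p\<bar> \<le> A $$ p"
  proof (rule finite_common_step[of "{..<m} \<times> {..<m}" "\<lambda>p. A $$ p" "case_prod D"])
  qed (use A zero in \<open>auto simp: U_top_iff\<close>)
  obtain e where e: "0 < e"
    "\<And>\<beta>. \<beta> \<in> Pow {..<m} \<Longrightarrow>
       e * \<bar>\<Sum>i\<in>\<beta>. \<Sum>j\<in>\<beta>. D i j\<bar> \<le> real (card \<beta>) - principal_sum A \<beta>"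
  proof (rule finite_common_step[of "Pow {..<m}"
        "\<lambda>\<beta>. real (card \<beta>) - principal_sum A \<beta>" "\<lambda>\<beta>. \<Sum>i\<in>\<beta>. \<Sum>j\<in>\<beta>. D i j"])
  qed (use A tight in \<open>auto simp: U_top_iff\<close>)
  define s where "s = min d e"
  have s: "0 < s" "s \<le> d" "s \<le> e"
    using d(1) e(1) by (auto simp: s_def)
  define M where "M c = mat m m (\<lambda>(i, j). A $$ (i, j) + c * D i j)" for c
  have M_sum: "principal_sum (M c) \<beta> = principal_sum A \<beta> + c * (\<Sum>i\<in>\<beta>. \<Sum>j\<in>\<beta>. D i j)"
    if "\<beta> \<subseteq> {..<m}" for c \<beta>
  proof -
    have "principal_sum (M c) \<beta> = (\<Sum>i\<in>\<beta>. \<Sum>j\<in>\<beta>. A $$ (i, j) + c * D i j)"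
      unfolding principal_sum_def by (intro sum.cong refl) (use that in \<open>auto simp: M_def subset_iff\<close>)
    then show ?thesis
      by (simp add: principal_sum_def sum.distrib sum_distrib_left)
  qed
  have M_U: "M c \<in> U_top m" if c: "\<bar>c\<bar> = s" for c
    unfolding U_top_iff
  proof (intro conjI allI impI)
    show "M c \<in> carrier_mat m m"
      by (simp add: M_def)
    fix k l assume kl: "k < m" "l < m"
    then show "M c $$ (k, l) = M c $$ (l, k)"
      using A sym[of k l] by (simp add: M_def U_top_iff)
    have "\<bar>c * D k l\<bar> \<le> d * \<bar>D k l\<bar>"
      using c s by (simp add: abs_mult mult_right_mono)
    also have "\<dots> \<le> A $$ (k, l)"
      using d(2)[of "(k, l)"] kl by simp
    finally show "0 \<le> M c $$ (k, l)"
      using kl by (simp add: M_def)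
  next
    fix \<beta> assume \<beta>: "\<beta> \<subseteq> {..<m}"
    have "\<bar>c * (\<Sum>i\<in>\<beta>. \<Sum>j\<in>\<beta>. D i j)\<bar> \<le> e * \<bar>\<Sum>i\<in>\<beta>. \<Sum>j\<in>\<beta>. D i j\<bar>"
      using c s by (simp add: abs_mult mult_right_mono)
    also have "\<dots> \<le> real (card \<beta>) - principal_sum A \<beta>"
      using e(2) \<beta> by simp
    finally show "principal_sum (M c) \<beta> \<le> real (card \<beta>)"
      using M_sum[OF \<beta>] by simp
  next
    \<comment> \<open>The full index set is tight in \<open>A\<close>, so \<open>D\<close> sums to
      zero over it and the total is unchanged.\<close>
    show "principal_sum (M c) {..<m} = real m"
      using M_sum[of "{..<m}" c] tight[of "{..<m}"] A by (simp add: U_top_iff)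
  qed
  have "A = (1 - 1 / 2) \<cdot>\<^sub>m M s + (1 / 2) \<cdot>\<^sub>m M (- s)"
    using A by (intro eq_matI) (auto simp: M_def U_top_iff field_simps)
  then have "\<exists>t::real. 0 < t \<and> t < 1 \<and> A = (1 - t) \<cdot>\<^sub>m M s + t \<cdot>\<^sub>m M (- s)"
    by (intro exI[of _ "1 / 2"]) simp
  moreover have "M s \<in> U_top m" "M (- s) \<in> U_top m"
    using M_U s(1) by auto
  ultimately have "M s = M (- s)"
    using ext unfolding mat_extreme_point_of_def by blast
  then have "M s $$ (i, j) = M (- s) $$ (i, j)"
    by simp
  then show ?thesis
    using ij s(1) by (simp add: M_def)
qed

section \<open>Principal submatrices and their reindexing\<close>

text \<open>\<open>pick \<alpha>\<close> enumerates \<alpha> increasingly from position 0; counting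
  the elements below a given one recovers its position.\<close>

lemma bij_betw_pick:
  assumes "finite \<alpha>"
  shows "bij_betw (pick \<alpha>) {..<card \<alpha>} \<alpha>"
proof -
  have "inj_on (pick \<alpha>) {..<card \<alpha>}"
    by (rule inj_on_inverseI[where g = "\<lambda>x. card {a \<in> \<alpha>. a < x}"]) (simp add: card_pick_le)
  moreover have "pick \<alpha> ` {..<card \<alpha>} \<subseteq> \<alpha>"
    using pick_in_set_le by auto
  ultimately show ?thesis
    using assms by (metis bij_betw_def card_image card_lessThan card_subset_eq)
qed

context
  fixes A :: "real mat" and m :: nat and \<alpha> :: "nat set"
  assumes A: "A \<in> carrier_mat m m" and \<alpha>: "\<alpha> \<subseteq> {..<m}"
begin

lemma principal_submatrix_carrier: "principal_submatrix A \<alpha> \<in> carrier_mat (card \<alpha>) (card \<alpha>)"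
proof -
  \<comment> \<open>The dimension of \<open>submatrix\<close> counts the indices of \<alpha> inside
    the range of the matrix; here these are all of \<alpha>.\<close>
  have "{i. i < m \<and> i \<in> \<alpha>} = \<alpha>"
    using \<alpha> by auto
  then show ?thesis
    by (intro carrier_matI)
      (simp_all only: principal_submatrix_def dim_submatrix carrier_matD[OF A])
qed

lemma principal_submatrix_index:
  assumes "i < card \<alpha>" "j < card \<alpha>"
  shows "principal_submatrix A \<alpha> $$ (i, j) = A $$ (pick \<alpha> i, pick \<alpha> j)"
proof -
  have "{i. i < m \<and> i \<in> \<alpha>} = \<alpha>"
    using \<alpha> by auto
  then show ?thesis
    unfolding principal_submatrix_def
    by (intro submatrix_index) (simp_all only: carrier_matD[OF A] assms)
qed

text \<open>Transfers bounds and tightness between the renumbered submatrix and \<open>A\<close>: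
  \<open>pick \<alpha>\<close> is injective, so the sum can be reindexed.\<close>

lemma principal_sum_principal_submatrix:
  assumes "\<gamma> \<subseteq> {..<card \<alpha>}"
  shows "principal_sum (principal_submatrix A \<alpha>) \<gamma> = principal_sum A (pick \<alpha> ` \<gamma>)"
proof -
  have inj: "inj_on (pick \<alpha>) \<gamma>"
    using bij_betw_pick[of \<alpha>] \<alpha> assms finite_subset by (blast dest: bij_betw_imp_inj_on inj_on_subset)
  have "principal_sum (principal_submatrix A \<alpha>) \<gamma> = (\<Sum>i\<in>\<gamma>. \<Sum>j\<in>\<gamma>. A $$ (pick \<alpha> i, pick \<alpha> j))"
    unfolding principal_sum_def
    by (intro sum.cong refl principal_submatrix_index) (use assms in auto)
  then show ?thesis
    by (simp add: principal_sum_def sum.reindex[OF inj])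
qed

end

text \<open>Renumbering preserves cardinalities, so every bound is inherited from \<open>A\<close>;
  tightness of \<alpha> supplies the required total.\<close>

lemma principal_submatrix_in_U_top:
  assumes A: "A \<in> U_top m" and \<alpha>: "\<alpha> \<subseteq> {..<m}" and tight: "principal_sum A \<alpha> = real (card \<alpha>)"
  shows "principal_submatrix A \<alpha> \<in> U_top (card \<alpha>)"
proof -
  have car: "A \<in> carrier_mat m m"
    using A by (simp add: U_top_iff)
  have bij: "bij_betw (pick \<alpha>) {..<card \<alpha>} \<alpha>"
    using bij_betw_pick \<alpha> finite_subset by blast
  have lt: "pick \<alpha> i < m" if "i < card \<alpha>" for i
    using bij_betwE[OF bij] \<alpha> that by blast
  have card: "card (pick \<alpha> ` \<gamma>) = card \<gamma>" if "\<gamma> \<subseteq> {..<card \<alpha>}" for \<gamma>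
    using card_image inj_on_subset[OF bij_betw_imp_inj_on[OF bij] that] by blast
  have sub: "pick \<alpha> ` \<gamma> \<subseteq> {..<m}" if "\<gamma> \<subseteq> {..<card \<alpha>}" for \<gamma>
    using lt that by auto
  show ?thesis
    unfolding U_top_iff
  proof (intro conjI allI impI)
    fix \<gamma> assume \<gamma>: "\<gamma> \<subseteq> {..<card \<alpha>}"
    show "principal_sum (principal_submatrix A \<alpha>) \<gamma> \<le> real (card \<gamma>)"
      using A sub[OF \<gamma>] unfolding principal_sum_principal_submatrix[OF car \<alpha> \<gamma>] card[OF \<gamma>, symmetric]
      by (simp add: U_top_iff)
  next
    show "principal_sum (principal_submatrix A \<alpha>) {..<card \<alpha>} = real (card \<alpha>)"
      using tight bij_betw_imp_surj_on[OF bij]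
      by (simp add: principal_sum_principal_submatrix[OF car \<alpha>])
  qed (use A lt in \<open>auto simp: principal_submatrix_carrier[OF car \<alpha>]
        principal_submatrix_index[OF car \<alpha>] U_top_iff\<close>)
qed

section \<open>Extremality passes to saturated principal submatrices\<close>

lemma extreme_point_principal_submatrix:
  assumes ext: "A mat_extreme_point_of U_top m"
    and \<alpha>: "\<alpha> \<subseteq> {..<m}" and tight: "principal_sum A \<alpha> = real (card \<alpha>)"
  shows "principal_submatrix A \<alpha> mat_extreme_point_of U_top (card \<alpha>)"
  unfolding mat_extreme_point_of_def
proof (intro conjI ballI notI)
  let ?k = "card \<alpha>" and ?p = "pick \<alpha>"
  have A: "A \<in> U_top m"
    using ext by (simp add: mat_extreme_point_of_def)
  then have car: "A \<in> carrier_mat m m"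
    by (simp add: U_top_iff)
  show "principal_submatrix A \<alpha> \<in> U_top ?k"
    using A \<alpha> tight by (rule principal_submatrix_in_U_top)
  fix B C assume B: "B \<in> U_top ?k" and C: "C \<in> U_top ?k"
    and "B \<noteq> C \<and> (\<exists>t. 0 < t \<and> t < 1 \<and> principal_submatrix A \<alpha> = (1 - t) \<cdot>\<^sub>m B + t \<cdot>\<^sub>m C)"
  then obtain t where ne: "B \<noteq> C" and t: "0 < t" "t < 1"
    and comb: "principal_submatrix A \<alpha> = (1 - t) \<cdot>\<^sub>m B + t \<cdot>\<^sub>m C"
    by blast
  have carBC: "B \<in> carrier_mat ?k ?k" "C \<in> carrier_mat ?k ?k"
    using B C by (simp_all add: U_top_iff)
  have bij: "bij_betw ?p {..<?k} \<alpha>"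
    using bij_betw_pick \<alpha> finite_subset by blast
  define q where "q = inv_into {..<?k} ?p"
  have qp: "q (?p i) = i" if "i < ?k" for i
    unfolding q_def using bij_betw_inv_into_left[OF bij] that by simp
  have pq: "?p (q i) = i" "q i < ?k" if "i \<in> \<alpha>" for i
    unfolding q_def using bij_betw_inv_into_right[OF bij that]
      bij_betwE[OF bij_betw_inv_into[OF bij]] that by auto
  \<comment> \<open>\<open>B\<close> and \<open>C\<close> are indexed by positions within \<alpha>;
    \<open>q\<close> turns an element of \<alpha> into its position, and the difference is extended
    by zero to all of \<open>A\<close>.\<close>
  define D where "D i j =
    (if i \<in> \<alpha> \<and> j \<in> \<alpha> then B $$ (q i, q j) - C $$ (q i, q j) else 0)" for i j
  have D0: "D i j = 0" if "i < m" "j < m" for i j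
  proof (rule extreme_point_no_direction[OF ext _ _ _ that])
    fix i j
    show "D i j = D j i"
      using B C pq(2) by (auto simp: D_def U_top_iff)
    assume zero: "A $$ (i, j) = 0"
    show "D i j = 0"
    proof (cases "i \<in> \<alpha> \<and> j \<in> \<alpha>")
      case True
      let ?b = "B $$ (q i, q j)" and ?c = "C $$ (q i, q j)"
      have "(1 - t) * ?b + t * ?c = principal_submatrix A \<alpha> $$ (q i, q j)"
        using comb convex_combination_index[OF carBC] pq(2) True by simp
      also have "\<dots> = 0"
        using principal_submatrix_index[OF car \<alpha>] True pq zero by simp
      \<comment> \<open>The signs are flipped so that nonnegativity of the entries becomes the upper
        bound 0; both entries must then vanish.\<close>
      finally have "(1 - t) * (- ?b) + t * (- ?c) = 0"
        by simp
      moreover have "- ?b \<le> 0" "- ?c \<le> 0"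
        using B C pq(2) True by (simp_all add: U_top_iff)
      ultimately show ?thesis
        using convex_combination_eq_upper_bound[OF t, of "- ?b" 0 "- ?c"] by (simp add: D_def)
    qed (auto simp: D_def)
  next
    fix \<beta> assume \<beta>: "\<beta> \<subseteq> {..<m}" "principal_sum A \<beta> = real (card \<beta>)"
    \<comment> \<open>The set \<alpha> \<inter> \<beta> in submatrix numbering. It is tight in
      \<open>A\<close>, hence also in \<open>B\<close> and \<open>C\<close>, whose sums over it
      agree.\<close>
    define \<gamma> where "\<gamma> = q ` (\<alpha> \<inter> \<beta>)"
    have \<gamma>: "\<gamma> \<subseteq> {..<?k}"
      using pq(2) by (auto simp: \<gamma>_def)
    have p\<gamma>: "?p ` \<gamma> = \<alpha> \<inter> \<beta>"
      using pq(1) by (force simp: \<gamma>_def image_image)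
    have inj: "inj_on ?p \<gamma>"
      using inj_on_subset[OF bij_betw_imp_inj_on[OF bij] \<gamma>] .
    have "principal_sum (principal_submatrix A \<alpha>) \<gamma> = real (card \<gamma>)"
      using tight_inter[OF A \<alpha> \<beta>(1) tight \<beta>(2)] card_image[OF inj]
      by (simp add: principal_sum_principal_submatrix[OF car \<alpha> \<gamma>] p\<gamma>)
    then have BC: "principal_sum B \<gamma> = principal_sum C \<gamma>"
      using tight_convex_combination[OF B C t \<gamma>] comb by simp
    have fin: "finite \<beta>"
      using \<beta>(1) finite_subset by blast
    \<comment> \<open>As \<open>D\<close> vanishes off \<alpha>, first the columns and then the rows
      reduce to \<alpha> \<inter> \<beta>, after which the sum is renumbered.\<close>
    have "(\<Sum>i\<in>\<beta>. \<Sum>j\<in>\<beta>. D i j) = (\<Sum>i\<in>\<beta>. \<Sum>j\<in>\<alpha> \<inter> \<beta>. D i j)"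
      using fin by (intro sum.cong refl sum.mono_neutral_right) (auto simp: D_def)
    also have "\<dots> = (\<Sum>i\<in>\<alpha> \<inter> \<beta>. \<Sum>j\<in>\<alpha> \<inter> \<beta>. D i j)"
      using fin by (intro sum.mono_neutral_right) (auto simp: D_def intro!: sum.neutral split: if_splits)
    also have "\<dots> = (\<Sum>i\<in>\<gamma>. \<Sum>j\<in>\<gamma>. D (?p i) (?p j))"
      by (simp add: p\<gamma>[symmetric] sum.reindex[OF inj])
    also have "\<dots> = (\<Sum>i\<in>\<gamma>. \<Sum>j\<in>\<gamma>. B $$ (i, j) - C $$ (i, j))"
      by (intro sum.cong refl) (use \<gamma> qp bij_betwE[OF bij] in \<open>auto simp: D_def subset_iff\<close>)
    also have "\<dots> = principal_sum B \<gamma> - principal_sum C \<gamma>"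
      by (simp add: principal_sum_def sum_subtractf)
    finally show "(\<Sum>i\<in>\<beta>. \<Sum>j\<in>\<beta>. D i j) = 0"
      using BC by simp
  qed
  have "B = C"
  proof (rule eq_matI)
    fix i j assume "i < dim_row C" "j < dim_col C"
    then have ij: "i < ?k" "j < ?k"
      using carBC by auto
    then have "?p i \<in> \<alpha>" "?p j \<in> \<alpha>"
      using bij_betwE[OF bij] by auto
    moreover from this have "D (?p i) (?p j) = 0"
      using \<alpha> by (intro D0) auto
    ultimately show "B $$ (i, j) = C $$ (i, j)"
      using ij by (simp add: D_def qp)
  qed (use carBC in auto)
  with ne show False ..
qed

section \<open>From local extremality back to the whole matrix\<close>

text \<open>On a saturated \<alpha> containing \<open>i\<close> and \<open>j\<close>, the
  submatrices of \<open>B\<close> and \<open>C\<close> lie in \<open>U_top (card \<alpha>)\<close>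
  and combine to that of \<open>A\<close>. Its extremality equates them, in particular at the entry
  \<open>(i, j)\<close>.\<close>

lemma extreme_point_if_cover:
  assumes A: "A \<in> U_top m"
    and cover: "\<And>i j. i < m \<Longrightarrow> j < m \<Longrightarrow> \<exists>\<alpha>. saturated_nbhd A i j \<alpha> \<and>
      principal_submatrix A \<alpha> mat_extreme_point_of U_top (card \<alpha>)"
  shows "A mat_extreme_point_of U_top m"
  unfolding mat_extreme_point_of_def
proof (intro conjI ballI notI)
  fix B C assume B: "B \<in> U_top m" and C: "C \<in> U_top m"
    and "B \<noteq> C \<and> (\<exists>t. 0 < t \<and> t < 1 \<and> A = (1 - t) \<cdot>\<^sub>m B + t \<cdot>\<^sub>m C)"
  then obtain t where ne: "B \<noteq> C" and t: "0 < t" "t < 1" and comb: "A = (1 - t) \<cdot>\<^sub>m B + t \<cdot>\<^sub>m C"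
    by blast
  have car: "A \<in> carrier_mat m m" "B \<in> carrier_mat m m" "C \<in> carrier_mat m m"
    using A B C by (simp_all add: U_top_iff)
  have "B = C"
  proof (rule eq_matI)
    fix i j assume "i < dim_row C" "j < dim_col C"
    then have ij: "i < m" "j < m"
      using car by auto
    then obtain \<alpha> where nb: "saturated_nbhd A i j \<alpha>"
      and ext: "principal_submatrix A \<alpha> mat_extreme_point_of U_top (card \<alpha>)"
      using cover by blast
    have \<alpha>: "\<alpha> \<subseteq> {..<m}" and tight: "principal_sum A \<alpha> = real (card \<alpha>)" and mem: "i \<in> \<alpha>" "j \<in> \<alpha>"
      using nb by (auto simp: saturated_nbhd_def saturated_iff[OF A])
    have bij: "bij_betw (pick \<alpha>) {..<card \<alpha>} \<alpha>"
      using bij_betw_pick \<alpha> finite_subset by blast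
    have tightBC: "principal_sum B \<alpha> = real (card \<alpha>)" "principal_sum C \<alpha> = real (card \<alpha>)"
      using tight_convex_combination[OF B C t \<alpha>] tight comb by simp_all
    note sub = principal_submatrix_carrier[OF _ \<alpha>]
    have "principal_submatrix A \<alpha> =
        (1 - t) \<cdot>\<^sub>m principal_submatrix B \<alpha> + t \<cdot>\<^sub>m principal_submatrix C \<alpha>"
    proof (rule eq_matI)
      fix k l
      assume "k < dim_row ((1 - t) \<cdot>\<^sub>m principal_submatrix B \<alpha> + t \<cdot>\<^sub>m principal_submatrix C \<alpha>)"
        "l < dim_col ((1 - t) \<cdot>\<^sub>m principal_submatrix B \<alpha> + t \<cdot>\<^sub>m principal_submatrix C \<alpha>)"
      then have kl: "k < card \<alpha>" "l < card \<alpha>"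
        using sub[OF car(3)] by auto
      then have "pick \<alpha> k < m" "pick \<alpha> l < m"
        using bij_betwE[OF bij] \<alpha> by blast+
      then have "A $$ (pick \<alpha> k, pick \<alpha> l) =
          (1 - t) * B $$ (pick \<alpha> k, pick \<alpha> l) + t * C $$ (pick \<alpha> k, pick \<alpha> l)"
        unfolding comb by (rule convex_combination_index[OF car(2,3)])
      then show "principal_submatrix A \<alpha> $$ (k, l) =
          ((1 - t) \<cdot>\<^sub>m principal_submatrix B \<alpha> + t \<cdot>\<^sub>m principal_submatrix C \<alpha>) $$ (k, l)"
        by (simp only: convex_combination_index[OF sub[OF car(2)] sub[OF car(3)] kl]
            car[THEN principal_submatrix_index, OF \<alpha> kl])
    qed (use sub[OF car(1)] sub[OF car(3)] in auto)
    moreover have "principal_submatrix B \<alpha> \<in> U_top (card \<alpha>)" "principal_submatrix C \<alpha> \<in> U_top (card \<alpha>)"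
      using principal_submatrix_in_U_top \<alpha> B C tightBC by blast+
    ultimately have eq: "principal_submatrix B \<alpha> = principal_submatrix C \<alpha>"
      using ext t unfolding mat_extreme_point_of_def by blast
    obtain k l where "k < card \<alpha>" "l < card \<alpha>" "i = pick \<alpha> k" "j = pick \<alpha> l"
      using mem bij_betw_imp_surj_on[OF bij] by (metis imageE lessThan_iff)
    then show "B $$ (i, j) = C $$ (i, j)"
      using eq principal_submatrix_index[OF car(2) \<alpha>] principal_submatrix_index[OF car(3) \<alpha>] by metis
  qed (use car in auto)
  with ne show False ..
qed (rule A)

text \<open>The full index set is a saturated neighborhood of every entry, and radii are natural
  numbers, so a least one is attained.\<close>

lemma minimal_saturated_nbhd_exists:
  assumes "A \<in> U_top m" "i < m" "j < m"
  shows "\<exists>\<alpha>. minimal_saturated_nbhd A i j \<alpha>"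
proof -
  have "saturated_nbhd A i j {..<m}"
    using assms by (auto simp: saturated_nbhd_def saturated_iff U_top_iff)
  then show ?thesis
    unfolding minimal_saturated_nbhd_def by (rule ex_has_least_nat)
qed

theorem theorem2p16:
  fixes m :: nat and A :: "real mat"
  assumes "A \<in> U_top m"
  shows "(A mat_extreme_point_of U_top m \<longleftrightarrow>
            (\<forall>i<m. \<forall>j<m. \<forall>\<alpha>. minimal_saturated_nbhd A i j \<alpha> \<longrightarrow>
               principal_submatrix A \<alpha> mat_extreme_point_of U_top (card \<alpha>))) \<and>
         (A mat_extreme_point_of U_top m \<longleftrightarrow>
            (\<forall>\<alpha>. saturated A \<alpha> \<longrightarrow>
               principal_submatrix A \<alpha> mat_extreme_point_of U_top (card \<alpha>)))"
    (is "(?i \<longleftrightarrow> ?ii) \<and> (?i \<longleftrightarrow> ?iii)")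
proof -
  \<comment> \<open>Both equivalences follow from the cycle (i), (iii), (ii), (i).\<close>
  have "?iii" if ?i
    using extreme_point_principal_submatrix[OF that] saturated_iff[OF assms] by blast
  moreover have "?ii" if ?iii
    using that by (simp add: minimal_saturated_nbhd_def saturated_nbhd_def)
  moreover have "?i" if ?ii
  proof (rule extreme_point_if_cover[OF assms])
    fix i j assume "i < m" "j < m"
    with that minimal_saturated_nbhd_exists[OF assms this]
    show "\<exists>\<alpha>. saturated_nbhd A i j \<alpha> \<and>
        principal_submatrix A \<alpha> mat_extreme_point_of U_top (card \<alpha>)"
      by (auto simp: minimal_saturated_nbhd_def)
  qed
  ultimately show ?thesis
    by blast
qed

end
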